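(* Let $g:[0,\infty)\to\mathbb{R}$ be monotonic nondecreasing. Then $\delta_g(Q,P)\ge 0$ for any $P,Q\in\mathcal{P}$.
   Context: $(X,\mathcal{A})$ is a measurable space with $|\mathcal{A}|>2$ and $\mu$ is a $\sigma$-finite measure on it. $\mathcal{P}$ is the set of all probability measures on $(X,\mathcal{A})$ which are absolutely continuous with respect to $\mu$; for $P,Q\in\mathcal{P}$, $p=\frac{dP}{d\mu}$ and $q=\frac{dQ}{d\mu}$ denote the Radon-Nikodym derivatives. For a measurable function $g:[0,\infty)\to\mathbb{R}$, the $\delta$-divergence is $$\delta_g(Q,P)=\int_X [q(x)-p(x)]\, g\!\left[\frac{q(x)}{p(x)}\right]d\mu(x).$$ *)

theory Defs
  imports "HOL-Analysis.Analysis" "HOL-Probability.Probability"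
begin

definition ac_prob_measures :: "'a measure \<Rightarrow> 'a measure set" where
  "ac_prob_measures M = {P. prob_space P \<and> sets P = sets M \<and> absolutely_continuous M P}"

text \<open>
  The Radon-Nikodym derivative of the library takes values in the extended nonnegative reals; for
  the measures considered here it is finite almost everywhere, so we pass to real values.
\<close>

definition density_of :: "'a measure \<Rightarrow> 'a measure \<Rightarrow> 'a \<Rightarrow> real" where
  "density_of M P x = enn2real (RN_deriv M P x)"

text \<open>
  Lebesgue integral of an extended-real function as the difference of the integrals of its
  positive and negative parts (\<^const>\<open>e2ennreal\<close> sends negative arguments to 0). The Bochner integral
  is not suitable: it is 0 for every non-integrable function, also when the value should be
  infinite. Since \<open>\<infinity> - \<infinity> = \<infinity>\<close> in \<^typ>\<open>ereal\<close>, the value of \<open>ext_integral\<close> is meaningful only if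
  \<open>has_ext_integral\<close> holds.
\<close>

definition has_ext_integral :: "'a measure \<Rightarrow> ('a \<Rightarrow> ereal) \<Rightarrow> bool" where
  "has_ext_integral M f \<longleftrightarrow> f \<in> borel_measurable M \<and>
     ((\<integral>\<^sup>+ x. e2ennreal (f x) \<partial>M) < \<infinity> \<or> (\<integral>\<^sup>+ x. e2ennreal (- f x) \<partial>M) < \<infinity>)"

definition ext_integral :: "'a measure \<Rightarrow> ('a \<Rightarrow> ereal) \<Rightarrow> ereal" where
  "ext_integral M f =
     enn2ereal (\<integral>\<^sup>+ x. e2ennreal (f x) \<partial>M) - enn2ereal (\<integral>\<^sup>+ x. e2ennreal (- f x) \<partial>M)"

text \<open>
  The expression \<open>(q - p) g(q / p)\<close> for \<open>p, q \<ge> 0\<close>. It equals \<open>p f(q / p)\<close> for \<open>f(t) = (t - 1) g(t)\<close>,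
  and for \<open>p = 0\<close> we use the customary conventions for f-divergences, \<open>0 f(0 / 0) = 0\<close> and
  \<open>0 f(q / 0) = q lim f(t) / t = q lim g(t)\<close> as \<open>t \<longrightarrow> \<infinity>\<close>, where the limit may be infinite.
  The case \<open>p = q = 0\<close> needs no separate clause, because \<open>0 * y = 0\<close> for all \<open>y\<close> in \<^typ>\<open>ereal\<close>.
  Only values of \<open>g\<close> on nonnegative arguments matter.
\<close>

definition delta_integrand :: "(real \<Rightarrow> real) \<Rightarrow> real \<Rightarrow> real \<Rightarrow> ereal" where
  "delta_integrand g q p =
     (if p = 0 then ereal q * Lim at_top (\<lambda>t. ereal (g t))
      else ereal ((q - p) * g (q / p)))"

definition delta_fun ::
  "'a measure \<Rightarrow> (real \<Rightarrow> real) \<Rightarrow> 'a measure \<Rightarrow> 'a measure \<Rightarrow> 'a \<Rightarrow> ereal" where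
  "delta_fun M g Q P x = delta_integrand g (density_of M Q x) (density_of M P x)"

definition delta_divergence ::
  "'a measure \<Rightarrow> (real \<Rightarrow> real) \<Rightarrow> 'a measure \<Rightarrow> 'a measure \<Rightarrow> ereal" where
  "delta_divergence M g Q P = ext_integral M (delta_fun M g Q P)"

end

(* Since g is nondecreasing, the integrand (q - p) g(q / p) dominates g(1) (q - p) pointwise. The
   latter function is integrable with integral g(1) (1 - 1) = 0, so its positive and negative
   parts have the same finite integral, which separates those of the integrand. *)

theory Submission
  imports Defs
begin

lemma mono_on_tendsto_SUP_at_top:
  fixes g :: "real \<Rightarrow> ereal"
  assumes "mono_on {a..} g"
  shows "(g \<longlongrightarrow> (SUP t\<in>{a..}. g t)) at_top"
proof (rule increasing_tendsto)
  show "\<forall>\<^sub>F t in at_top. g t \<le> (SUP t\<in>{a..}. g t)"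
    using eventually_ge_at_top[of a] by eventually_elim (auto intro: SUP_upper)
next
  fix x assume "x < (SUP t\<in>{a..}. g t)"
  then obtain t where t: "t \<ge> a" "x < g t"
    by (auto simp: less_SUP_iff)
  show "\<forall>\<^sub>F s in at_top. x < g s"
    using eventually_ge_at_top[of t]
  proof eventually_elim
    case (elim s)
    have "g t \<le> g s"
      using assms t(1) elim by (auto intro: mono_onD)
    with t(2) show ?case by simp
  qed
qed

text \<open>\<open>Lim\<close> is a definite description and says something about \<open>g\<close>
  only once convergence is known. Passing to \<open>ereal\<close> secures this: a nondecreasing
  function converges there to its supremum, finite or infinite, and a supremum bounds each
  value.\<close>

lemma mono_on_le_Lim_at_top:
  fixes g :: "real \<Rightarrow> real"
  assumes "mono_on {a..} g" "a \<le> t"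
  shows "ereal (g t) \<le> Lim at_top (\<lambda>t. ereal (g t))"
proof -
  have "mono_on {a..} (\<lambda>t. ereal (g t))"
    using assms(1) by (auto simp: mono_on_def)
  then have "Lim at_top (\<lambda>t. ereal (g t)) = (SUP t\<in>{a..}. ereal (g t))"
    by (intro tendsto_Lim mono_on_tendsto_SUP_at_top) auto
  with assms(2) show ?thesis
    by (auto intro: SUP_upper)
qed

text \<open>The quotient \<open>q / p\<close> lies on the same side of 1 as \<open>q\<close> does of
  \<open>p\<close>, so by monotonicity the factors \<open>q - p\<close> and
  \<open>g (q / p) - g 1\<close> never have opposite signs. For \<open>p = 0\<close> the limit takes
  the place of \<open>g (q / p)\<close>, and it is at least \<open>g 1\<close>.\<close>

lemma delta_integrand_ge:
  assumes "mono_on {0..} g" "0 \<le> p" "0 \<le> q"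
  shows "ereal (g 1 * (q - p)) \<le> delta_integrand g q p"
proof (cases "p = 0")
  case True
  have "ereal q * ereal (g 1) \<le> ereal q * Lim at_top (\<lambda>t. ereal (g t))"
    using assms by (intro ereal_mult_left_mono mono_on_le_Lim_at_top) auto
  with True show ?thesis by (simp add: delta_integrand_def mult.commute)
next
  case False
  with assms have p: "p > 0" by simp
  have "0 \<le> (q - p) * (g (q / p) - g 1)"
  proof (cases "p \<le> q")
    case True
    then have "g 1 \<le> g (q / p)"
      using p assms by (intro mono_onD[OF assms(1)]) auto
    with True show ?thesis by simp
  next
    case False
    then have "g (q / p) \<le> g 1"
      using p assms by (intro mono_onD[OF assms(1)]) auto
    with False show ?thesis by (intro mult_nonpos_nonpos) auto
  qed
  with False show ?thesis by (simp add: delta_integrand_def algebra_simps)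
qed

lemma borel_measurable_delta_integrand:
  assumes "mono_on {0..} g"
    and [measurable]: "q \<in> borel_measurable M" "p \<in> borel_measurable M"
    and nonneg: "\<And>x. 0 \<le> q x" "\<And>x. 0 \<le> p x"
  shows "(\<lambda>x. delta_integrand g (q x) (p x)) \<in> borel_measurable M"
proof -
  \<comment> \<open>On negative arguments \<open>g\<close> is arbitrary, possibly not measurable.
    Clamping the argument at 0 gives a globally monotone, hence Borel, function, and the integrand
    does not change because the quotients are nonnegative.\<close>
  have "mono (\<lambda>t. g (max 0 t))"
    using assms(1) by (auto simp: mono_def intro!: mono_onD[OF assms(1)])
  then have [measurable]: "(\<lambda>t. g (max 0 t)) \<in> borel_measurable borel"
    by (rule borel_measurable_mono)
  have "(\<lambda>x. delta_integrand g (q x) (p x)) =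
      (\<lambda>x. if p x = 0 then ereal (q x) * Lim at_top (\<lambda>t. ereal (g t))
           else ereal ((q x - p x) * (\<lambda>t. g (max 0 t)) (q x / p x)))"
    using nonneg by (auto simp: delta_integrand_def max_absorb2)
  also have "\<dots> \<in> borel_measurable M"
    by measurable
  finally show ?thesis .
qed

lemma has_bochner_integral_density_of:
  assumes "sigma_finite_measure M" "P \<in> ac_prob_measures M"
  shows "has_bochner_integral M (density_of M P) 1"
proof -
  interpret sigma_finite_measure M by fact
  interpret P: prob_space P using assms(2) by (simp add: ac_prob_measures_def)
  have P: "absolutely_continuous M P" "sets P = sets M"
    using assms(2) by (auto simp: ac_prob_measures_def)
  have sf: "sigma_finite_measure P"
    by (rule P.sigma_finite_measure_axioms)
  show ?thesis
    \<comment> \<open>Change of measure for the constant 1: its integral under \<open>P\<close> is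
      the total mass 1, and under \<open>M\<close> it becomes the integral of the density.\<close>
    using RN_deriv_integrable[OF sf P, of "\<lambda>_. 1"] RN_deriv_integral[OF sf P, of "\<lambda>_. 1"]
    by (simp add: has_bochner_integral_iff density_of_def[abs_def] P.prob_space)
qed

text \<open>With f^+ and f^- for the positive and negative parts, the integrals satisfy f^- \<le>
  h^- = h^+ \<le> f^+. The middle two are finite, whereas that of f^+ may be infinite, so
  \<open>f\<close> need not be integrable.\<close>

lemma ext_integral_nonneg_if_ge_integrable:
  assumes f: "f \<in> borel_measurable M"
    and h: "has_bochner_integral M h 0"
    and le: "\<And>x. x \<in> space M \<Longrightarrow> ereal (h x) \<le> f x"
  shows "has_ext_integral M f" "0 \<le> ext_integral M f"
proof -
  have int: "integrable M h" and "(\<integral>x. h x \<partial>M) = 0"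
    using h by (auto simp: has_bochner_integral_iff)
  then have eq: "enn2real (\<integral>\<^sup>+x. ennreal (h x) \<partial>M) = enn2real (\<integral>\<^sup>+x. ennreal (- h x) \<partial>M)"
    by (simp add: real_lebesgue_integral_def)
  have fin: "(\<integral>\<^sup>+x. ennreal (h x) \<partial>M) < \<infinity>" "(\<integral>\<^sup>+x. ennreal (- h x) \<partial>M) < \<infinity>"
    using int by (auto simp: real_integrable_def less_top)
  have neg: "(\<integral>\<^sup>+x. e2ennreal (- f x) \<partial>M) \<le> (\<integral>\<^sup>+x. ennreal (- h x) \<partial>M)"
  proof (intro nn_integral_mono)
    fix x assume "x \<in> space M"
    then have "- f x \<le> ereal (- h x)"
      using le[of x] by (simp flip: ereal_minus_le_minus[of "f x"])
    then show "e2ennreal (- f x) \<le> ennreal (- h x)"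
      using e2ennreal_mono by fastforce
  qed
  have pos: "(\<integral>\<^sup>+x. ennreal (h x) \<partial>M) \<le> (\<integral>\<^sup>+x. e2ennreal (f x) \<partial>M)"
    using le e2ennreal_mono by (intro nn_integral_mono) (force simp flip: e2ennreal_ereal)
  show "has_ext_integral M f"
    using f neg fin by (auto simp: has_ext_integral_def intro: le_less_trans)
  \<comment> \<open>\<open>enn2real\<close> sends infinity to 0, so finiteness of both sides is what
    lifts the equality of reals back to \<open>ennreal\<close>.\<close>
  have "(\<integral>\<^sup>+x. ennreal (h x) \<partial>M) = (\<integral>\<^sup>+x. ennreal (- h x) \<partial>M)"
    using eq fin by (metis ennreal_enn2real infinity_ennreal_def)
  with neg pos have "(\<integral>\<^sup>+x. e2ennreal (- f x) \<partial>M) \<le> (\<integral>\<^sup>+x. e2ennreal (f x) \<partial>M)"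
    by simp
  moreover have "(\<integral>\<^sup>+x. e2ennreal (- f x) \<partial>M) < \<infinity>"
    using neg fin(2) by (rule le_less_trans)
  ultimately show "0 \<le> ext_integral M f"
    unfolding ext_integral_def
    by (subst ereal_diff_positive) (auto simp: less_eq_ennreal.rep_eq)
qed

theorem theorem7:
  fixes M :: "'a measure" and g :: "real \<Rightarrow> real" and P Q :: "'a measure"
  assumes "sigma_finite_measure M"
    and "infinite (sets M) \<or> card (sets M) > 2"
    and "mono_on {0..} g"
    and "P \<in> ac_prob_measures M"
    and "Q \<in> ac_prob_measures M"
  shows "has_ext_integral M (delta_fun M g Q P) \<and> 0 \<le> delta_divergence M g Q P"
proof -
  \<comment> \<open>The value is left unevaluated so that it matches the rules for scaling and
    difference, each density contributing 1.\<close>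
  have "has_bochner_integral M (\<lambda>x. g 1 * (density_of M Q x - density_of M P x)) (g 1 * (1 - 1))"
    using assms by (intro has_bochner_integral_mult_right has_bochner_integral_diff
        has_bochner_integral_density_of)
  then have h: "has_bochner_integral M (\<lambda>x. g 1 * (density_of M Q x - density_of M P x)) 0"
    by simp
  have f: "delta_fun M g Q P \<in> borel_measurable M"
    unfolding delta_fun_def[abs_def] using assms(3)
    by (rule borel_measurable_delta_integrand) (auto simp: density_of_def[abs_def])
  \<comment> \<open>This holds at every point, not just almost everywhere, since
    \<open>enn2real\<close> makes both densities nonnegative throughout.\<close>
  have le: "ereal (g 1 * (density_of M Q x - density_of M P x)) \<le> delta_fun M g Q P x" for x
    unfolding delta_fun_def using assms(3)
    by (rule delta_integrand_ge) (auto simp: density_of_def)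
  show ?thesis
    using ext_integral_nonneg_if_ge_integrable[OF f h le] by (simp add: delta_divergence_def)
qed

end
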